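(* Let $(G_1,a_1,x,y)$ and $(G_2,a_2,x,y)$ be weak fragments with $V(G_1)\cap V(G_2)=\{x,y\}$. If both of them are medium fragments, or at least one of them is a strong fragment, then the graph $G_1:G_2$ is traceable and has fault cost $1$.
   Context: Graphs are finite, simple and undirected. A graph is hamiltonian if it has a cycle through all its vertices ($K_1,K_2$ are not); traceable if it has a hamiltonian path; a hamiltonian $ab$-path is a path through all vertices with end-vertices $a,b$. For a connected graph $H$ and vertices $a,x,y\in V(H)$ with $xy\in E(H)$, consider: ($P_0$) $H$ has a hamiltonian $ax$-path or a hamiltonian $ay$-path, and for every $v\in V(H)\setminus\{a\}$, $H-v$ has a hamiltonian $ax$-path or a hamiltonian $ay$-path; ($Q_1$) $H$ has no hamiltonian $xy$-path; ($Q_2$) for every $v\in V(H)\setminus\{a\}$, $H-v$ has no hamiltonian $xy$-path. $(H,a,x,y)$ is a weak fragment if it satisfies ($P_0$), a medium fragment if it satisfies ($P_0$) and ($Q_1$), and a strong fragment if it satisfies ($P_0$), ($Q_1$), ($Q_2$). If $V(G_1)\cap V(G_2)=\{x,y\}$, then $G_1:G_2$ is the graph with vertex set $V(G_1)\cup V(G_2)$ and edge set $E(G_1)\cup E(G_2)$. The minimum leaf number ${\rm ml}(G)$ is $1$ if $G$ is hamiltonian, $\infty$ if $G$ is disconnected, and otherwise the minimum number of leaves of a spanning tree. An ml-subgraph is a hamiltonian cycle if $G$ is hamiltonian, otherwise a spanning tree with ${\rm ml}(G)$ leaves; ${\cal S}_{\rm ml}(G)$ is the set of these. For $S\in{\cal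 S}_{\rm ml}(G)$, $v\in V(G)$, $S_v\in{\cal S}_{\rm ml}(G-v)$, $\tau(S,S_v)=|\{u\in V(G)\setminus\{v\}:\deg_S(u)\ne\deg_{S_v}(u)\}|$, $\varphi_S(G)=\max_{v}\min_{S_v}\tau(S,S_v)$, and the fault cost is $\varphi(G)=\min_{S}\varphi_S(G)$. *)

theory Defs
  imports "HOL-Library.Extended_Nat"
begin

section \<open>Finite simple graphs\<close>

datatype 'a graph = Graph (verts: "'a set") (edges: "'a set set")

definition simple_graph :: "'a graph \<Rightarrow> bool" where
  "simple_graph G \<longleftrightarrow> finite (verts G) \<and> (\<forall>e\<in>edges G. e \<subseteq> verts G \<and> card e = 2)"

definition subgraph :: "'a graph \<Rightarrow> 'a graph \<Rightarrow> bool" where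
  "subgraph H G \<longleftrightarrow> simple_graph H \<and> verts H \<subseteq> verts G \<and> edges H \<subseteq> edges G"

definition degree :: "'a graph \<Rightarrow> 'a \<Rightarrow> nat" where
  "degree G u = card {e \<in> edges G. u \<in> e}"

definition delete_vertex :: "'a graph \<Rightarrow> 'a \<Rightarrow> 'a graph" where
  "delete_vertex G v = Graph (verts G - {v}) {e \<in> edges G. v \<notin> e}"

text \<open>The union of two graphs; it is only used for graphs that share exactly the two
  vertices \<open>x\<close> and \<open>y\<close>.\<close>

definition join :: "'a graph \<Rightarrow> 'a graph \<Rightarrow> 'a graph" where
  "join G1 G2 = Graph (verts G1 \<union> verts G2) (edges G1 \<union> edges G2)"

section \<open>Paths, cycles, trees\<close>

text \<open>Paths and cycles are the graphs traced by lists of pairwise distinct vertices. A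
  one-vertex graph is a path, and a cycle has at least three vertices.\<close>

definition path_graph :: "'a list \<Rightarrow> 'a graph" where
  "path_graph p = Graph (set p) {{p ! i, p ! Suc i} | i. Suc i < length p}"

definition cycle_graph :: "'a list \<Rightarrow> 'a graph" where
  "cycle_graph p = Graph (set p) {{p ! i, p ! (Suc i mod length p)} | i. i < length p}"

definition path_in :: "'a graph \<Rightarrow> 'a list \<Rightarrow> bool" where
  "path_in G p \<longleftrightarrow> p \<noteq> [] \<and> distinct p \<and> subgraph (path_graph p) G"

definition cycle_in :: "'a graph \<Rightarrow> 'a list \<Rightarrow> bool" where
  "cycle_in G p \<longleftrightarrow> length p \<ge> 3 \<and> distinct p \<and> subgraph (cycle_graph p) G"

definition connected :: "'a graph \<Rightarrow> bool" where
  "connected G \<longleftrightarrow> verts G \<noteq> {} \<and>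
     (\<forall>u\<in>verts G. \<forall>v\<in>verts G. \<exists>p. path_in G p \<and> hd p = u \<and> last p = v)"

definition tree :: "'a graph \<Rightarrow> bool" where
  "tree T \<longleftrightarrow> simple_graph T \<and> connected T \<and> (\<nexists>p. cycle_in T p)"

definition spanning_tree :: "'a graph \<Rightarrow> 'a graph \<Rightarrow> bool" where
  "spanning_tree G T \<longleftrightarrow> tree T \<and> subgraph T G \<and> verts T = verts G"

definition leaves :: "'a graph \<Rightarrow> 'a set" where
  "leaves T = {u \<in> verts T. degree T u = 1}"

definition hamiltonian_path :: "'a graph \<Rightarrow> 'a list \<Rightarrow> bool" where
  "hamiltonian_path G p \<longleftrightarrow> path_in G p \<and> set p = verts G"

definition hamiltonian_cycle :: "'a graph \<Rightarrow> 'a list \<Rightarrow> bool" where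
  "hamiltonian_cycle G p \<longleftrightarrow> cycle_in G p \<and> set p = verts G"

definition traceable :: "'a graph \<Rightarrow> bool" where
  "traceable G \<longleftrightarrow> (\<exists>p. hamiltonian_path G p)"

definition hamiltonian :: "'a graph \<Rightarrow> bool" where
  "hamiltonian G \<longleftrightarrow> (\<exists>p. hamiltonian_cycle G p)"

text \<open>The end-vertices \<open>a\<close> and \<open>b\<close> of an \<open>ab\<close>-path are two different vertices: a one-vertex
  path is not an \<open>aa\<close>-path. This matters below only in that it forces \<open>a \<notin> {x, y}\<close> in
  a weak fragment \<open>(H, a, x, y)\<close>; otherwise the single edge \<open>xy\<close> with \<open>a = x\<close> would be a
  weak fragment.\<close>

definition has_hamiltonian_path_between :: "'a graph \<Rightarrow> 'a \<Rightarrow> 'a \<Rightarrow> bool" where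
  "has_hamiltonian_path_between G a b \<longleftrightarrow>
     a \<noteq> b \<and> (\<exists>p. hamiltonian_path G p \<and> hd p = a \<and> last p = b)"

section \<open>Fragments\<close>

definition fragment_P0 :: "'a graph \<Rightarrow> 'a \<Rightarrow> 'a \<Rightarrow> 'a \<Rightarrow> bool" where
  "fragment_P0 H a x y \<longleftrightarrow>
     (has_hamiltonian_path_between H a x \<or> has_hamiltonian_path_between H a y) \<and>
     (\<forall>v\<in>verts H - {a}.
        has_hamiltonian_path_between (delete_vertex H v) a x \<or>
        has_hamiltonian_path_between (delete_vertex H v) a y)"

definition fragment_Q1 :: "'a graph \<Rightarrow> 'a \<Rightarrow> 'a \<Rightarrow> bool" where
  "fragment_Q1 H x y \<longleftrightarrow> \<not> has_hamiltonian_path_between H x y"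

definition fragment_Q2 :: "'a graph \<Rightarrow> 'a \<Rightarrow> 'a \<Rightarrow> 'a \<Rightarrow> bool" where
  "fragment_Q2 H a x y \<longleftrightarrow>
     (\<forall>v\<in>verts H - {a}. \<not> has_hamiltonian_path_between (delete_vertex H v) x y)"

definition weak_fragment :: "'a graph \<Rightarrow> 'a \<Rightarrow> 'a \<Rightarrow> 'a \<Rightarrow> bool" where
  "weak_fragment H a x y \<longleftrightarrow>
     simple_graph H \<and> connected H \<and> {a, x, y} \<subseteq> verts H \<and> {x, y} \<in> edges H \<and>
     fragment_P0 H a x y"

definition medium_fragment :: "'a graph \<Rightarrow> 'a \<Rightarrow> 'a \<Rightarrow> 'a \<Rightarrow> bool" where
  "medium_fragment H a x y \<longleftrightarrow> weak_fragment H a x y \<and> fragment_Q1 H x y"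

definition strong_fragment :: "'a graph \<Rightarrow> 'a \<Rightarrow> 'a \<Rightarrow> 'a \<Rightarrow> bool" where
  "strong_fragment H a x y \<longleftrightarrow>
     weak_fragment H a x y \<and> fragment_Q1 H x y \<and> fragment_Q2 H a x y"

section \<open>Minimum leaf number and fault cost\<close>

definition ml :: "'a graph \<Rightarrow> enat" where
  "ml G = (if hamiltonian G then 1
           else if \<not> connected G then \<infinity>
           else (INF T\<in>{T. spanning_tree G T}. enat (card (leaves T))))"

definition ml_subgraphs :: "'a graph \<Rightarrow> 'a graph set" where
  "ml_subgraphs G =
     (if hamiltonian G then {cycle_graph p | p. hamiltonian_cycle G p}
      else {T. spanning_tree G T \<and> enat (card (leaves T)) = ml G})"

definition transition_cost :: "'a graph \<Rightarrow> 'a \<Rightarrow> 'a graph \<Rightarrow> 'a graph \<Rightarrow> nat" where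
  "transition_cost G v S Sv = card {u \<in> verts G - {v}. degree S u \<noteq> degree Sv u}"

text \<open>Minima and maxima are taken in \<open>enat\<close>, so that the minimum over an empty set of
  ml-subgraphs (when \<open>G\<close> or \<open>G - v\<close> is disconnected) is \<open>\<infinity>\<close>. The other minima and the
  maxima over nonempty vertex sets are attained.\<close>

definition fault_cost_wrt :: "'a graph \<Rightarrow> 'a graph \<Rightarrow> enat" where
  "fault_cost_wrt G S =
     (SUP v\<in>verts G. INF Sv\<in>ml_subgraphs (delete_vertex G v). enat (transition_cost G v S Sv))"

definition fault_cost :: "'a graph \<Rightarrow> enat" where
  "fault_cost G = (INF S\<in>ml_subgraphs G. fault_cost_wrt G S)"

end

theory Submission
  imports Defs
begin

text \<open>Deleting \<open>x\<close> or \<open>y\<close> in \<open>P\<^sub>0\<close> yields a path from \<open>a\<^sub>i\<close> to the other vertex of the pair, so any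
  path required by \<open>P\<^sub>0\<close> in one fragment can be continued through the other one. Hence
  \<open>G = G\<^sub>1 : G\<^sub>2\<close> has a hamiltonian \<open>a\<^sub>1a\<^sub>2\<close>-path, and so has \<open>G - v\<close> for \<open>v \<notin> {a\<^sub>1, a\<^sub>2}\<close>, while
  \<open>G - a\<^sub>1\<close> has a hamiltonian path ending in \<open>a\<^sub>2\<close>. A hamiltonian cycle of \<open>G\<close> or \<open>G - v\<close> would
  split at \<open>x\<close> and \<open>y\<close> into hamiltonian \<open>xy\<close>-paths of both sides, which \<open>Q\<^sub>1\<close> and \<open>Q\<^sub>2\<close> exclude; so
  these paths are ml-subgraphs and the fault cost is at most 1. It is not 0 because degree sums
  are even: deleting a leaf of any spanning tree forces a change of degree.\<close>

section \<open>Paths and cycles as vertex lists\<close>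

abbreviation adj :: "'a graph \<Rightarrow> 'a \<Rightarrow> 'a \<Rightarrow> bool" where
  "adj G u v \<equiv> {u, v} \<in> edges G"

text \<open>The splitting vertex \<open>y\<close> stays in both halves, so that a closed walk can be
  cut into arcs that keep their end-vertices.\<close>

lemma successively_append_Cons_iff:
  "successively P (A @ y # B) \<longleftrightarrow> successively P (A @ [y]) \<and> successively P (y # B)"
  by (cases B) (auto simp: successively_append_iff)

lemma successively_inner:
  assumes "successively P (u # A @ [w])"
  shows "successively P A"
  using assms by (simp add: successively_Cons successively_append_iff split: if_splits)

lemma simple_graph_edgeD:
  assumes "simple_graph G" "{u, v} \<in> edges G"
  shows "u \<in> verts G" "v \<in> verts G" "u \<noteq> v"
  using assms by (fastforce simp: simple_graph_def)+

lemma simple_graph_edgeE: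
  assumes "simple_graph G" "e \<in> edges G" "u \<in> e"
  obtains v where "e = {u, v}" "v \<noteq> u"
proof -
  have "card e = 2" using assms by (auto simp: simple_graph_def)
  then obtain a b where "e = {a, b}" "a \<noteq> b" by (auto simp: card_2_iff)
  then show ?thesis using assms(3) that by (cases "u = a") auto
qed

lemma finite_edges:
  assumes "simple_graph G"
  shows "finite (edges G)"
  using assms by (auto simp: simple_graph_def intro: finite_subset[of _ "Pow (verts G)"])

lemma verts_path_graph [simp]: "verts (path_graph p) = set p"
  by (simp add: path_graph_def)

lemma verts_cycle_graph [simp]: "verts (cycle_graph p) = set p"
  by (simp add: cycle_graph_def)

text \<open>Replaces the indexed edge set by a recursion along the list, so that later proofs can
  induct on \<open>p\<close>; index 0 gives the first edge and \<open>Suc i\<close> the edges of the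
  tail.\<close>

lemma edges_path_graph_simps [simp]:
  "edges (path_graph []) = {}"
  "edges (path_graph [u]) = {}"
  "edges (path_graph (u # v # p)) = insert {u, v} (edges (path_graph (v # p)))"
proof -
  show "edges (path_graph (u # v # p)) = insert {u, v} (edges (path_graph (v # p)))"
    (is "?L = ?R")
  proof
    show "?L \<subseteq> ?R"
    proof
      fix e assume "e \<in> ?L"
      then obtain i where i: "e = {(u # v # p) ! i, (v # p) ! i}" "i < Suc (length p)"
        by (auto simp: path_graph_def)
      then show "e \<in> ?R" by (cases i) (auto simp: path_graph_def)
    qed
    show "?R \<subseteq> ?L"
    proof
      fix e assume "e \<in> ?R"
      then consider "e = {u, v}" | i where "e = {(v # p) ! i, p ! i}" "i < length p"
        by (auto simp: path_graph_def)
      then show "e \<in> ?L"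
      proof cases
        case 1
        then show ?thesis by (auto simp: path_graph_def intro: exI[of _ 0])
      next
        case (2 i)
        then show ?thesis by (auto simp: path_graph_def intro!: exI[of _ "Suc i"])
      qed
    qed
  qed
qed (auto simp: path_graph_def)

lemma edge_path_graph_subset: "e \<in> edges (path_graph p) \<Longrightarrow> e \<subseteq> set p"
  by (induction p rule: induct_list012) auto

lemma simple_path_graph:
  assumes "distinct p"
  shows "simple_graph (path_graph p)"
proof -
  have "card e = 2" if "e \<in> edges (path_graph p)" for e
    using assms that by (induction p rule: induct_list012) auto
  then show ?thesis using edge_path_graph_subset by (auto simp: simple_graph_def)
qed

lemma edges_path_graph_subset_iff:
  "edges (path_graph p) \<subseteq> edges G \<longleftrightarrow> successively (adj G) p"
  by (induction p rule: induct_list012) auto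

lemma path_in_iff:
  "path_in G p \<longleftrightarrow> p \<noteq> [] \<and> distinct p \<and> set p \<subseteq> verts G \<and> successively (adj G) p"
  by (auto simp: path_in_def subgraph_def simple_path_graph edges_path_graph_subset_iff[symmetric])

lemma edges_cycle_graph:
  assumes "p \<noteq> []"
  shows "edges (cycle_graph p) = insert {last p, hd p} (edges (path_graph p))"
proof -
  have "edges (cycle_graph p) = (\<lambda>i. {p ! i, p ! (Suc i mod length p)}) ` {i. i < length p}"
    by (auto simp: cycle_graph_def)
  \<comment> \<open>\<open>length p - 1\<close> is the only index whose successor wraps around to 0;
    it yields the closing edge.\<close>
  also have "{i. i < length p} = insert (length p - 1) {i. Suc i < length p}"
    using assms by (cases p) auto
  also have "(\<lambda>i. {p ! i, p ! (Suc i mod length p)}) ` \<dots> =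
      insert {last p, hd p} (edges (path_graph p))"
    using assms by (auto simp: path_graph_def last_conv_nth hd_conv_nth)
  finally show ?thesis .
qed

text \<open>Otherwise the indices 0 and \<open>length p - 1\<close> would be consecutive, which
  forces length 2. Hence the closing edge of a cycle is new and raises the degree of both
  ends.\<close>

lemma last_hd_notin_path_graph:
  assumes "distinct p" "length p \<ge> 3"
  shows "{last p, hd p} \<notin> edges (path_graph p)"
proof
  assume *: "{last p, hd p} \<in> edges (path_graph p)"
  have "last p = p ! (length p - 1)" "hd p = p ! 0"
    using assms(2) last_conv_nth[of p] hd_conv_nth[of p] by (cases p; simp)+
  then obtain i where i: "Suc i < length p" "{p ! (length p - 1), p ! 0} = {p ! i, p ! Suc i}"
    using * unfolding path_graph_def by auto
  then have "p ! 0 = p ! i \<and> p ! (length p - 1) = p ! Suc i \<or>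
      p ! 0 = p ! Suc i \<and> p ! (length p - 1) = p ! i"
    by (auto simp: doubleton_eq_iff)
  moreover have "0 < length p" "length p - 1 < length p" "i < length p"
    using i(1) by auto
  ultimately have "0 = i \<and> length p - 1 = Suc i \<or> 0 = Suc i \<and> length p - 1 = i"
    using i(1) assms(1) nth_eq_iff_index_eq by metis
  then show False using assms(2) by auto
qed

lemma cycle_in_iff:
  "cycle_in G p \<longleftrightarrow> length p \<ge> 3 \<and> distinct p \<and> set p \<subseteq> verts G \<and>
     successively (adj G) p \<and> adj G (last p) (hd p)"
proof (cases "length p \<ge> 3 \<and> distinct p")
  case True
  then have ne: "p \<noteq> []" by auto
  obtain u v r where p: "p = u # v # r" using True
    by (cases p; cases "tl p") auto
  have "last p \<noteq> hd p" using True p by auto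
  then have "simple_graph (cycle_graph p)"
    using simple_path_graph[of p] True ne
    by (auto simp: simple_graph_def edges_cycle_graph)
  then show ?thesis
    using True ne
    by (auto simp: cycle_in_def subgraph_def edges_cycle_graph edges_path_graph_subset_iff)
qed (auto simp: cycle_in_def)

section \<open>Reversing, cutting, gluing and rotating paths and cycles\<close>

lemma path_in_rev: "path_in G (rev p) \<longleftrightarrow> path_in G p"
  by (auto simp: path_in_iff insert_commute)

lemma path_in_infix:
  assumes "path_in G (A @ B @ C)" "B \<noteq> []"
  shows "path_in G B"
  using assms by (auto simp: path_in_iff successively_append_iff)

lemma path_in_mono:
  assumes "path_in H p" "verts H \<subseteq> verts G" "edges H \<subseteq> edges G"
  shows "path_in G p"
  using assms by (auto simp: path_in_iff elim!: successively_mono)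

lemma path_in_glue:
  assumes "path_in G p" "path_in G q" "last p = hd q" "set p \<inter> set q = {hd q}"
  shows "path_in G (p @ tl q)"
proof -
  obtain c q' where q: "q = c # q'" using assms(2) by (cases q) (auto simp: path_in_iff)
  show ?thesis
    using assms unfolding q
    by (cases q') (auto simp: path_in_iff successively_append_iff)
qed

text \<open>Only inclusions of edge sets are required, since \<open>G\<close> may have further
  edges, for instance at a vertex that was deleted from \<open>H2\<close> but lies in
  \<open>H1\<close>.\<close>

lemma hamiltonian_path_glue:
  assumes "hamiltonian_path H1 p" "hamiltonian_path H2 q" "last p = hd q"
    "verts H1 \<inter> verts H2 = {hd q}"
    "verts G = verts H1 \<union> verts H2" "edges H1 \<subseteq> edges G" "edges H2 \<subseteq> edges G"
  shows "hamiltonian_path G (p @ tl q)"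
proof -
  have p: "path_in G p" "set p = verts H1" and q: "path_in G q" "set q = verts H2"
    using assms by (auto simp: hamiltonian_path_def intro: path_in_mono)
  have "set (p @ tl q) = set p \<union> set q"
    using p(1) q(1) assms(3) last_in_set[of p] by (cases q) (auto simp: path_in_iff)
  then show ?thesis
    using path_in_glue[of G p q] p q assms by (auto simp: hamiltonian_path_def)
qed

text \<open>Two vertices are joined by the segment of \<open>p\<close> between them, reversed if
  they occur on \<open>p\<close> in the opposite order.\<close>

lemma connected_if_hamiltonian_path:
  assumes "hamiltonian_path G p"
  shows "connected G"
proof -
  have p: "path_in G p" and V: "verts G = set p"
    using assms by (auto simp: hamiltonian_path_def)
  have fw: "\<exists>q. path_in G q \<and> hd q = u \<and> last q = v"
    if pA: "p = A @ u # B" and vB: "v \<in> set (u # B)" for u v A B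
  proof -
    obtain C D where "u # B = C @ v # D" using split_list[OF vB] by fast
    moreover from this have "C @ [v] \<noteq> []" "hd (C @ [v]) = u" by (cases C; auto)+
    moreover have "path_in G (C @ [v])"
      using path_in_infix[of G A "C @ [v]" D] p pA calculation(1) by simp
    ultimately show ?thesis by (metis last_snoc)
  qed
  have "\<exists>q. path_in G q \<and> hd q = u \<and> last q = v" if u: "u \<in> set p" and v: "v \<in> set p" for u v
  proof -
    obtain A B where A: "p = A @ u # B" using split_list[OF u] by blast
    show ?thesis
    proof (cases "v \<in> set (u # B)")
      case True
      then show ?thesis using fw A by blast
    next
      case False
      then have "v \<in> set A" using v A by auto
      then obtain C D where "A = C @ v # D" by (meson split_list)
      then obtain q where "path_in G q" "hd q = v" "last q = u"
        using fw[of C v "D @ u # B" u] A by auto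
      moreover from this have "q \<noteq> []" by (simp add: path_in_iff)
      ultimately show ?thesis
        by (metis path_in_rev hd_rev last_rev)
    qed
  qed
  then show ?thesis using p V by (auto simp: connected_def path_in_iff)
qed

text \<open>If the cycle is \<open>A @ x # B\<close>, reading it from \<open>x\<close> gives
  \<open>x # B @ A\<close>; the old closing edge becomes an inner one, and the final
  \<open>x\<close> records the new closing edge.\<close>

lemma hamiltonian_cycle_rotate:
  assumes "hamiltonian_cycle G p" "x \<in> verts G"
  obtains q where "distinct (x # q)" "set (x # q) = verts G" "successively (adj G) (x # q @ [x])"
proof -
  have p: "distinct p" "successively (adj G) p" "adj G (last p) (hd p)" "set p = verts G"
    using assms(1) by (auto simp: hamiltonian_cycle_def cycle_in_iff)
  then obtain A B where AB: "p = A @ x # B" using assms(2) split_list by metis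
  have "successively (adj G) (x # (B @ A) @ [x])"
    using p(2,3) successively_append_Cons_iff[of "adj G" A x B]
      successively_append_iff[of "adj G" "x # B" "A @ [x]"]
    by (cases A) (auto simp: AB split: if_splits)
  moreover have "distinct (x # B @ A)" "set (x # B @ A) = verts G"
    using p AB by auto
  ultimately show thesis using that by blast
qed

section \<open>Degrees\<close>

lemma degree_insert_edge:
  assumes "finite (edges H)" "e \<notin> edges H" "edges G = insert e (edges H)"
  shows "degree G w = degree H w + of_bool (w \<in> e)"
proof (cases "w \<in> e")
  case True
  then have "{f \<in> edges G. w \<in> f} = insert e {f \<in> edges H. w \<in> f}" using assms by auto
  then show ?thesis using True assms by (simp add: degree_def)
next
  case False
  then have "{f \<in> edges G. w \<in> f} = {f \<in> edges H. w \<in> f}" using assms by auto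
  then show ?thesis using False by (simp add: degree_def)
qed

text \<open>The equation is stated without subtraction; on a one-vertex path both end terms count.\<close>

lemma degree_path_graph:
  assumes "distinct p" "p \<noteq> []"
  shows "degree (path_graph p) w + of_bool (w = hd p) + of_bool (w = last p)
    = 2 * of_bool (w \<in> set p)"
  using assms
proof (induction p rule: induct_list012)
  case (3 u v p)
  have "{u, v} \<notin> edges (path_graph (v # p))"
    using 3(3) edge_path_graph_subset[of "{u, v}" "v # p"] by auto
  moreover have "finite (edges (path_graph (v # p)))"
    using 3(3) by (intro finite_edges simple_path_graph) auto
  ultimately have "degree (path_graph (u # v # p)) w
      = degree (path_graph (v # p)) w + of_bool (w \<in> {u, v})"
    by (intro degree_insert_edge) auto
  then show ?case using 3 by (auto split: if_splits)
qed (auto simp: degree_def)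

text \<open>The closing edge adds one at each end of the path, where the degree was 1.\<close>

lemma degree_cycle_graph:
  assumes "distinct p" "length p \<ge> 3"
  shows "degree (cycle_graph p) w = 2 * of_bool (w \<in> set p)"
proof -
  have ne: "p \<noteq> []" using assms by auto
  have neq: "hd p \<noteq> last p" using assms by (cases p; cases "tl p") auto
  have "degree (cycle_graph p) w = degree (path_graph p) w + of_bool (w \<in> {last p, hd p})"
    using assms ne
    by (intro degree_insert_edge finite_edges simple_path_graph last_hd_notin_path_graph
        edges_cycle_graph)
  moreover have "hd p \<in> set p" "last p \<in> set p" using ne by auto
  ultimately show ?thesis using degree_path_graph[OF assms(1) ne, of w] neq by auto
qed

text \<open>Double counting of the incidences between vertices and edges.\<close>

lemma handshake:
  assumes "simple_graph G"
  shows "(\<Sum>u\<in>verts G. degree G u) = 2 * card (edges G)"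
proof -
  have "\<forall>e\<in>edges G. card {u \<in> verts G. u \<in> e} = 2"
  proof
    fix e assume "e \<in> edges G"
    then have "e \<subseteq> verts G" "card e = 2" using assms by (auto simp: simple_graph_def)
    moreover from this have "{u \<in> verts G. u \<in> e} = e" by auto
    ultimately show "card {u \<in> verts G. u \<in> e} = 2" by simp
  qed
  then show ?thesis
    unfolding degree_def
    using assms by (intro sum_multicount finite_edges) (auto simp: simple_graph_def)
qed

section \<open>Trees\<close>

text \<open>Induction by removing the first vertex \<open>u\<close>: it has degree 1 in the path,
  whereas every vertex of a cycle has degree 2, so a cycle avoids \<open>u\<close> and lies in the
  shorter path.\<close>

lemma path_graph_acyclic:
  assumes "distinct p"
  shows "\<not> cycle_in (path_graph p) q"
  using assms
proof (induction p rule: induct_list012)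
  case 1
  then show ?case by (auto simp: cycle_in_iff)
next
  case (2 u)
  show ?case
  proof
    assume "cycle_in (path_graph [u]) q"
    then have "adj (path_graph [u]) (last q) (hd q)" unfolding cycle_in_iff by blast
    then show False by simp
  qed
next
  case (3 u v p)
  show ?case
  proof
    assume *: "cycle_in (path_graph (u # v # p)) q"
    then have q: "distinct q" "length q \<ge> 3"
      and sub: "edges (cycle_graph q) \<subseteq> edges (path_graph (u # v # p))"
      by (auto simp: cycle_in_def subgraph_def)
    have "degree (cycle_graph q) u \<le> degree (path_graph (u # v # p)) u"
      unfolding degree_def
      using sub finite_edges[OF simple_path_graph[OF 3(3)]]
      by (intro card_mono) auto
    also have "\<dots> = 1"
      using degree_path_graph[OF 3(3), of u] 3(3) last_in_set[of "v # p"]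
      by (auto simp: of_bool_def split: if_splits)
    finally have u: "u \<notin> set q"
      using degree_cycle_graph[OF q, of u] by auto
    have "edges (cycle_graph q) \<subseteq> edges (path_graph (v # p))"
    proof
      fix e assume e: "e \<in> edges (cycle_graph q)"
      have "e \<subseteq> set q"
        using e * by (auto simp: cycle_in_def subgraph_def simple_graph_def)
      then show "e \<in> edges (path_graph (v # p))"
        using e sub u by auto
    qed
    then have "cycle_in (path_graph (v # p)) q"
      using * u by (auto simp: cycle_in_def subgraph_def)
    then show False using 3 by simp
  qed
qed

lemma spanning_tree_path_graph:
  assumes "hamiltonian_path G p"
  shows "spanning_tree G (path_graph p)"
proof -
  have p: "path_in G p" "set p = verts G" using assms by (auto simp: hamiltonian_path_def)
  have d: "distinct p" using p by (simp add: path_in_iff)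
  have "hamiltonian_path (path_graph p) p"
    using p by (auto simp: hamiltonian_path_def path_in_iff edges_path_graph_subset_iff[symmetric])
  then have "connected (path_graph p)" by (rule connected_if_hamiltonian_path)
  then have "tree (path_graph p)"
    using d simple_path_graph path_graph_acyclic by (auto simp: tree_def)
  then show ?thesis using p by (auto simp: spanning_tree_def path_in_def)
qed

lemma card_leaves_path_graph:
  assumes "distinct p" "length p \<ge> 2"
  shows "card (leaves (path_graph p)) = 2"
proof -
  have ne: "p \<noteq> []" using assms by auto
  have neq: "hd p \<noteq> last p" using assms by (cases p; cases "tl p") auto
  have "leaves (path_graph p) = {hd p, last p}"
  proof (intro set_eqI)
    fix w
    show "w \<in> leaves (path_graph p) \<longleftrightarrow> w \<in> {hd p, last p}"
      using degree_path_graph[OF assms(1) ne, of w] neq ne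
      by (auto simp: leaves_def of_bool_def split: if_splits)
  qed
  then show ?thesis using neq by simp
qed

text \<open>A neighbour of the first vertex off \<open>p\<close> would extend \<open>p\<close> at
  the front, and a neighbour on \<open>p\<close> beyond the second vertex would close a cycle. So
  the second vertex is the only neighbour.\<close>

lemma hd_longest_path_leaf:
  assumes T: "tree T" and p: "path_in T p" "length p \<ge> 2"
    and max: "\<And>q. path_in T q \<Longrightarrow> length q \<le> length p"
  shows "hd p \<in> leaves T"
proof -
  obtain u w r where pr: "p = u # w # r"
    using p(2) by (cases p; cases "tl p") auto
  have sg: "simple_graph T" using T by (simp add: tree_def)
  have e0: "adj T u w" using p(1) by (simp add: pr path_in_iff)
  have "e = {u, w}" if e: "e \<in> edges T" "u \<in> e" for e
  proof -
    obtain z where z: "e = {u, z}" "z \<noteq> u"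
      using simple_graph_edgeE[OF sg e] by blast
    have zT: "z \<in> verts T" using simple_graph_edgeD[OF sg] e z by auto
    have "z \<in> set p"
    proof (rule ccontr)
      assume "z \<notin> set p"
      then have "path_in T (z # p)"
        using p(1) zT e z by (auto simp: pr path_in_iff insert_commute)
      then show False using max by fastforce
    qed
    moreover have "z \<notin> set r"
    proof
      assume "z \<in> set r"
      then obtain A B where r: "r = A @ z # B" by (meson split_list)
      have "path_in T (u # w # A @ [z])"
        using path_in_infix[of T "[]" "u # w # A @ [z]" B] p(1) by (simp add: pr r)
      moreover have "adj T (last (u # w # A @ [z])) (hd (u # w # A @ [z]))"
        using e z by (simp add: insert_commute[of z])
      ultimately have "cycle_in T (u # w # A @ [z])"
        unfolding path_in_iff cycle_in_iff by simp
      then show False using T by (auto simp: tree_def)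
    qed
    ultimately show ?thesis using z by (auto simp: pr)
  qed
  then have "{e \<in> edges T. u \<in> e} = {{u, w}}" using e0 by blast
  then show ?thesis
    using simple_graph_edgeD(1)[OF sg e0] by (simp add: leaves_def degree_def pr)
qed

text \<open>Both ends of a longest path are leaves; the second end is treated by reversing the
  path.\<close>

lemma tree_two_leaves:
  assumes T: "tree T" and uv: "u \<in> verts T" "v \<in> verts T" "u \<noteq> v"
  shows "2 \<le> card (leaves T)"
proof -
  have fin: "finite (verts T)" using T by (auto simp: tree_def simple_graph_def)
  obtain p0 where p0: "path_in T p0" "hd p0 = u" "last p0 = v"
    using T uv unfolding tree_def connected_def by blast
  \<comment> \<open>A path repeats no vertex, so path lengths are bounded and a longest path
    exists.\<close>
  have "\<forall>q. path_in T q \<longrightarrow> length q < Suc (card (verts T))"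
    using fin by (auto simp: path_in_iff less_Suc_eq_le distinct_card[symmetric] intro: card_mono)
  then obtain p where p: "path_in T p" "\<And>q. path_in T q \<Longrightarrow> length q \<le> length p"
    using ex_has_greatest_nat[of "path_in T" p0 length] p0(1) by blast
  \<comment> \<open>The path from \<open>u\<close> to \<open>v\<close> ensures that a longest path
    has two different ends.\<close>
  have "length p0 \<ge> 2" using p0 uv by (cases p0; cases "tl p0") (auto simp: path_in_iff)
  then have len: "length p \<ge> 2" using p(2)[OF p0(1)] by simp
  have "hd p \<in> leaves T" by (rule hd_longest_path_leaf[OF T p(1) len p(2)])
  moreover have "hd (rev p) \<in> leaves T"
    using p len by (intro hd_longest_path_leaf[OF T]) (auto simp: path_in_rev)
  moreover have "hd p \<noteq> hd (rev p)"
    unfolding hd_rev using p(1) len by (cases p; cases "tl p") (auto simp: path_in_iff)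
  ultimately have "card {hd p, hd (rev p)} \<le> card (leaves T)"
    using fin by (intro card_mono) (auto simp: leaves_def)
  then show ?thesis using \<open>hd p \<noteq> hd (rev p)\<close> by simp
qed

section \<open>Minimum leaf number and fault cost of traceable graphs\<close>

text \<open>A hamiltonian path is a spanning tree with two leaves, and no tree on at least two
  vertices has fewer. So \<open>ml G = 2\<close> and every hamiltonian path attains it.\<close>

lemma path_graph_ml_subgraph:
  assumes nh: "\<not> hamiltonian G" and p: "hamiltonian_path G p" "length p \<ge> 2"
  shows "path_graph p \<in> ml_subgraphs G"
proof -
  have d: "distinct p" "set p = verts G" using p by (auto simp: hamiltonian_path_def path_in_iff)
  obtain u v where uv: "u \<in> verts G" "v \<in> verts G" "u \<noteq> v"
    using p(2) d by (cases p; cases "tl p") auto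
  have st: "spanning_tree G (path_graph p)" by (rule spanning_tree_path_graph[OF p(1)])
  have cl: "card (leaves (path_graph p)) = 2" by (rule card_leaves_path_graph[OF d(1) p(2)])
  have "(INF T\<in>{T. spanning_tree G T}. enat (card (leaves T))) = 2"
  proof (rule antisym)
    show "(INF T\<in>{T. spanning_tree G T}. enat (card (leaves T))) \<le> 2"
      using st cl by (intro INF_lower2[of "path_graph p"]) (auto simp: numeral_eq_enat)
    show "2 \<le> (INF T\<in>{T. spanning_tree G T}. enat (card (leaves T)))"
      using uv tree_two_leaves[of _ u v]
      by (intro INF_greatest) (auto simp: numeral_eq_enat spanning_tree_def)
  qed
  then have "ml G = 2" using nh connected_if_hamiltonian_path[OF p(1)] by (simp add: ml_def)
  then show ?thesis using nh st cl by (simp add: ml_subgraphs_def numeral_eq_enat)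
qed

section \<open>Lower bound on the fault cost by parity\<close>

lemma ml_subgraph_simple:
  assumes "S \<in> ml_subgraphs G"
  shows "simple_graph S" "verts S = verts G"
  using assms
  by (auto simp: ml_subgraphs_def hamiltonian_cycle_def cycle_in_def subgraph_def spanning_tree_def
      split: if_splits)

text \<open>Deleting a leaf of \<open>S\<close> must change some degree, since degree sums are even.\<close>

lemma transition_cost_leaf_pos:
  assumes S: "simple_graph S" "verts S = verts G" "v \<in> leaves S"
    and Sv: "simple_graph Sv" "verts Sv = verts G - {v}"
  shows "1 \<le> transition_cost G v S Sv"
proof (rule ccontr)
  assume "\<not> ?thesis"
  then have "card {u \<in> verts G - {v}. degree S u \<noteq> degree Sv u} = 0"
    by (simp add: transition_cost_def)
  moreover have fin: "finite (verts G)" using S by (auto simp: simple_graph_def)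
  ultimately have eq: "degree S u = degree Sv u" if "u \<in> verts G - {v}" for u
    using that by auto
  have v: "v \<in> verts G" "degree S v = 1" using S by (auto simp: leaves_def)
  have "2 * card (edges S) = (\<Sum>u\<in>verts G. degree S u)" using handshake[OF S(1)] S(2) by simp
  also have "\<dots> = 1 + (\<Sum>u\<in>verts G - {v}. degree S u)"
    using fin v by (simp add: sum.remove)
  also have "(\<Sum>u\<in>verts G - {v}. degree S u) = (\<Sum>u\<in>verts Sv. degree Sv u)"
    using eq Sv(2) by (intro sum.cong) auto
  also have "\<dots> = 2 * card (edges Sv)" by (rule handshake[OF Sv(1)])
  finally show False by presburger
qed

text \<open>As \<open>G\<close> is not hamiltonian, each ml-subgraph \<open>S\<close> is a spanning
  tree and has a leaf \<open>v\<close>; the deletion of this \<open>v\<close> already costs at least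
  1, whatever ml-subgraph of \<open>G - v\<close> is chosen.\<close>

lemma fault_cost_ge_1:
  assumes nh: "\<not> hamiltonian G" and uv: "u \<in> verts G" "w \<in> verts G" "u \<noteq> w"
  shows "1 \<le> fault_cost G"
  unfolding fault_cost_def
proof (rule INF_greatest)
  fix S assume S: "S \<in> ml_subgraphs G"
  have sS: "simple_graph S" "verts S = verts G" using ml_subgraph_simple[OF S] by auto
  have "spanning_tree G S" using S nh by (simp add: ml_subgraphs_def)
  then have "2 \<le> card (leaves S)"
    using uv by (intro tree_two_leaves[of S u w]) (auto simp: spanning_tree_def)
  then have "leaves S \<noteq> {}" by auto
  then obtain v where v: "v \<in> leaves S" by blast
  show "1 \<le> fault_cost_wrt G S"
    unfolding fault_cost_wrt_def
  proof (rule SUP_upper2[of v])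
    show "v \<in> verts G" using v sS by (auto simp: leaves_def)
    show "1 \<le> (INF Sv\<in>ml_subgraphs (delete_vertex G v). enat (transition_cost G v S Sv))"
    proof (rule INF_greatest)
      fix Sv assume "Sv \<in> ml_subgraphs (delete_vertex G v)"
      then have "simple_graph Sv" "verts Sv = verts G - {v}"
        using ml_subgraph_simple[of Sv "delete_vertex G v"] by (simp_all add: delete_vertex_def)
      then show "1 \<le> enat (transition_cost G v S Sv)"
        using transition_cost_leaf_pos[OF sS v] by (simp add: one_enat_def)
    qed
  qed
qed

section \<open>Upper bounds on transition costs\<close>

lemma transition_cost_le_1:
  assumes "\<And>u. u \<in> verts G - {v} \<Longrightarrow> u \<noteq> c \<Longrightarrow> degree S u = degree Sv u"
  shows "transition_cost G v S Sv \<le> 1"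
proof -
  have "{u \<in> verts G - {v}. degree S u \<noteq> degree Sv u} \<subseteq> {c}" using assms by blast
  then show ?thesis unfolding transition_cost_def
    by (metis card_mono finite.emptyI finite_insert card.empty card_insert_if One_nat_def empty_iff)
qed

lemma verts_delete_vertex [simp]: "verts (delete_vertex G v) = verts G - {v}"
  by (simp add: delete_vertex_def)

text \<open>If \<open>G - v\<close> is hamiltonian, the cycle changes only the degree of the other end of \<open>p\<close>;
  otherwise the given path changes at most the degree of its first vertex.\<close>

lemma fault_end_vertex:
  assumes p: "hamiltonian_path G p" "hd p = a \<and> last p = b \<or> hd p = b \<and> last p = a" "a \<noteq> b"
    and q: "hamiltonian_path (delete_vertex G a) q" "last q = b" "length q \<ge> 2"
  shows "\<exists>Sv\<in>ml_subgraphs (delete_vertex G a). transition_cost G a (path_graph p) Sv \<le> 1"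
proof (cases "hamiltonian (delete_vertex G a)")
  case True
  then obtain c where c: "hamiltonian_cycle (delete_vertex G a) c"
    by (auto simp: hamiltonian_def)
  then have *: "distinct c" "length c \<ge> 3" "set c = verts G - {a}"
    by (auto simp: hamiltonian_cycle_def cycle_in_iff)
  have "transition_cost G a (path_graph p) (cycle_graph c) \<le> 1"
  proof (rule transition_cost_le_1[of _ _ b])
    fix u assume "u \<in> verts G - {a}" "u \<noteq> b"
    then show "degree (path_graph p) u = degree (cycle_graph c) u"
      using degree_path_graph[of p u] degree_cycle_graph[of c u] p *
      by (auto simp: hamiltonian_path_def path_in_iff)
  qed
  then show ?thesis using True c by (auto simp: ml_subgraphs_def)
next
  case False
  have "transition_cost G a (path_graph p) (path_graph q) \<le> 1"
  proof (rule transition_cost_le_1[of _ _ "hd q"])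
    fix u assume "u \<in> verts G - {a}" "u \<noteq> hd q"
    then show "degree (path_graph p) u = degree (path_graph q) u"
      using degree_path_graph[of p u] degree_path_graph[of q u] p q
      by (auto simp: hamiltonian_path_def path_in_iff)
  qed
  then show ?thesis using path_graph_ml_subgraph[OF False q(1,3)] by blast
qed

section \<open>Hamiltonian cycles through a two-vertex cut\<close>

lemma verts_join [simp]: "verts (join G1 G2) = verts G1 \<union> verts G2"
  by (simp add: join_def)

lemma edges_join [simp]: "edges (join G1 G2) = edges G1 \<union> edges G2"
  by (simp add: join_def)

lemma join_commute: "join G1 G2 = join G2 G1"
  by (simp add: join_def Un_commute)

lemma delete_vertex_join:
  "delete_vertex (join G1 G2) v = join (delete_vertex G1 v) (delete_vertex G2 v)"
  by (auto simp: delete_vertex_def join_def)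

lemma delete_vertex_idem:
  assumes "simple_graph G" "v \<notin> verts G"
  shows "delete_vertex G v = G"
proof -
  have "{e \<in> edges G. v \<notin> e} = edges G" using assms by (auto simp: simple_graph_def)
  then show ?thesis using assms by (cases G) (simp add: delete_vertex_def)
qed

lemma simple_delete_vertex: "simple_graph G \<Longrightarrow> simple_graph (delete_vertex G v)"
  by (auto simp: simple_graph_def delete_vertex_def)

text \<open>Each edge of the join lies within one side, so a walk can change sides only at a common
  vertex.\<close>

lemma join_walk_one_side:
  assumes "simple_graph H1" "simple_graph H2"
    and "successively (adj (join H1 H2)) q" "set q \<subseteq> verts H1 \<union> verts H2"
    and "set q \<inter> verts H1 \<inter> verts H2 = {}"
  shows "set q \<subseteq> verts H1 \<or> set q \<subseteq> verts H2"
  using assms(3-)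
proof (induction q rule: induct_list012)
  case (3 u v q)
  have "set (v # q) \<subseteq> verts H1 \<or> set (v # q) \<subseteq> verts H2" using 3 by auto
  moreover have "u \<in> verts H1 \<and> v \<in> verts H1 \<or> u \<in> verts H2 \<and> v \<in> verts H2"
    using 3(3) simple_graph_edgeD[OF assms(1)] simple_graph_edgeD[OF assms(2)] by auto
  ultimately show ?case using 3(5) by auto
qed auto

text \<open>Every edge of the walk has an end in \<open>A\<close>, which is disjoint from
  \<open>H2\<close>, and so comes from \<open>H1\<close>. With \<open>A\<close> empty the single
  edge between \<open>u\<close> and \<open>w\<close> might come from \<open>H2\<close>.\<close>

lemma join_walk_in_side:
  assumes "simple_graph H2" "A \<noteq> []" "set A \<inter> verts H2 = {}"
    and "successively (adj (join H1 H2)) (u # A @ [w])"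
  shows "successively (adj H1) (u # A @ [w])"
  using assms(2-)
proof (induction A arbitrary: u)
  case (Cons c A)
  have "adj H1 u c" using Cons(3,4) simple_graph_edgeD[OF assms(1)] by auto
  moreover have "successively (adj H1) (c # A @ [w])"
  proof (cases "A = []")
    case True
    then show ?thesis using Cons(3,4) simple_graph_edgeD[OF assms(1)] by auto
  next
    case False
    then show ?thesis using Cons by auto
  qed
  ultimately show ?case by simp
qed simp

text \<open>Without \<open>z\<close> the cycle becomes a walk that stays on one side, yet it must
  visit both \<open>b1\<close> and \<open>b2\<close>.\<close>

lemma cut_vertex_not_hamiltonian:
  assumes sg: "simple_graph H1" "simple_graph H2"
    and V: "verts H1 \<inter> verts H2 = {z}" and b: "b1 \<in> verts H1 - {z}" "b2 \<in> verts H2 - {z}"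
  shows "\<not> hamiltonian (join H1 H2)"
proof
  assume "hamiltonian (join H1 H2)"
  then obtain p where "hamiltonian_cycle (join H1 H2) p" by (auto simp: hamiltonian_def)
  moreover have "z \<in> verts (join H1 H2)" using V by auto
  ultimately obtain q where q: "distinct (z # q)" "set (z # q) = verts (join H1 H2)"
      "successively (adj (join H1 H2)) (z # q @ [z])"
    by (rule hamiltonian_cycle_rotate)
  have "successively (adj (join H1 H2)) q"
    using q(3) by (rule successively_inner)
  then have "set q \<subseteq> verts H1 \<or> set q \<subseteq> verts H2"
    using q(1,2) V by (intro join_walk_one_side[OF sg]) auto
  moreover have "b1 \<in> set q" "b2 \<in> set q" using q(2) b by auto
  ultimately show False using b V by auto
qed

text \<open>The vertices \<open>x\<close> and \<open>y\<close> cut the cycle into two arcs, the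
  interior of each lying on one side. Since \<open>b1\<close> and \<open>b2\<close> must both be
  visited, the arcs lie on different sides, and the one through \<open>b1\<close> spans
  \<open>H1\<close>.\<close>

lemma hamiltonian_join_path:
  assumes sg: "simple_graph H1" "simple_graph H2"
    and V: "verts H1 \<inter> verts H2 = {x, y}" "x \<noteq> y"
    and b: "b1 \<in> verts H1 - {x, y}" "b2 \<in> verts H2 - {x, y}"
    and ham: "hamiltonian (join H1 H2)"
  shows "has_hamiltonian_path_between H1 x y"
proof -
  let ?J = "join H1 H2"
  obtain p where "hamiltonian_cycle ?J p" using ham by (auto simp: hamiltonian_def)
  moreover have "x \<in> verts ?J" using V by auto
  ultimately obtain q where q: "distinct (x # q)" "set (x # q) = verts ?J"
      "successively (adj ?J) (x # q @ [x])"
    by (rule hamiltonian_cycle_rotate)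
  have "y \<in> set q" using q(2) V by auto
  then obtain A B where AB: "q = A @ y # B" by (meson split_list)
  have sA: "successively (adj ?J) (x # A @ [y])" and sB: "successively (adj ?J) (y # B @ [x])"
    using q(3) successively_append_Cons_iff[of _ "x # A" y "B @ [x]"] by (simp_all add: AB)
  have side: "set C \<subseteq> verts H1 \<or> set C \<subseteq> verts H2"
    if "successively (adj ?J) (u # C @ [w])" "set C \<subseteq> set q - {x, y}" for C u w
  proof (intro join_walk_one_side[OF sg])
    show "successively (adj ?J) C"
      using that(1) by (rule successively_inner)
    show "set C \<subseteq> verts H1 \<union> verts H2" using that(2) q(2) by auto
    show "set C \<inter> verts H1 \<inter> verts H2 = {}" using that(2) V(1) by auto
  qed
  have A: "set A \<subseteq> verts H1 \<or> set A \<subseteq> verts H2"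
    using q(1) by (intro side[OF sA]) (auto simp: AB)
  have B: "set B \<subseteq> verts H1 \<or> set B \<subseteq> verts H2"
    using q(1) by (intro side[OF sB]) (auto simp: AB)
  have all: "verts H1 \<union> verts H2 = {x, y} \<union> set A \<union> set B"
    using q(2) AB by auto
  have dis: "set A \<inter> {x, y} = {}" "set B \<inter> {x, y} = {}" using q(1) AB by auto
  \<comment> \<open>One argument for both arcs: \<open>C\<close> is the interior on the side of
    \<open>H1\<close> and \<open>D\<close> the other one. As \<open>D\<close> lies in
    \<open>H2\<close> and avoids the cut, it misses \<open>H1\<close>, so \<open>C\<close> contains
    all of \<open>H1\<close> except \<open>x\<close> and \<open>y\<close>.\<close>
  have arc: "hamiltonian_path H1 (u # C @ [w])"
    if s: "successively (adj ?J) (u # C @ [w])" and uw: "{u, w} = {x, y}"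
      and d: "distinct (u # C @ [w])" and b1: "b1 \<in> set C" and C: "set C \<subseteq> verts H1"
      and D: "set D \<subseteq> verts H2" "verts H1 \<union> verts H2 = {x, y} \<union> set C \<union> set D"
      and dD: "set C \<inter> {x, y} = {}" "set D \<inter> {x, y} = {}" for u C w D
  proof -
    have "successively (adj H1) (u # C @ [w])"
      using b1 C dD(1) V(1) by (intro join_walk_in_side[OF sg(2) _ _ s]) auto
    moreover have "set (u # C @ [w]) = {x, y} \<union> set C" using uw by auto
    moreover have "\<dots> = verts H1" using C D dD V(1) by blast
    ultimately show ?thesis using d by (simp add: hamiltonian_path_def path_in_iff)
  qed
  have "b1 \<in> set A \<union> set B" "b2 \<in> set A \<union> set B" using all b by auto
  then consider "b1 \<in> set A" "set A \<subseteq> verts H1" "set B \<subseteq> verts H2"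
    | "b1 \<in> set B" "set B \<subseteq> verts H1" "set A \<subseteq> verts H2"
    using A B b V(1) by blast
  then show ?thesis
  proof cases
    case 1
    have "hamiltonian_path H1 (x # A @ [y])"
      using q(1) AB all dis 1 by (intro arc[OF sA, of B]) auto
    then show ?thesis using V(2) unfolding has_hamiltonian_path_between_def
      by (intro conjI exI[of _ "x # A @ [y]"]) auto
  next
    case 2
    have "hamiltonian_path H1 (y # B @ [x])"
      using q(1) AB all dis 2 by (intro arc[OF sB, of A]) auto
    \<comment> \<open>The second arc runs from \<open>y\<close> to \<open>x\<close>.\<close>
    then have "hamiltonian_path H1 (rev (y # B @ [x]))"
      unfolding hamiltonian_path_def path_in_rev set_rev .
    then show ?thesis using V(2) unfolding has_hamiltonian_path_between_def
      by (intro conjI exI[of _ "rev (y # B @ [x])"]) auto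
  qed
qed

section \<open>Joining fragments\<close>

lemma has_hamiltonian_path_between_verts:
  assumes "has_hamiltonian_path_between G a b"
  shows "a \<in> verts G" "b \<in> verts G" "a \<noteq> b"
  using assms
  by (auto simp: has_hamiltonian_path_between_def hamiltonian_path_def path_in_iff)

lemma has_hamiltonian_path_between_commute:
  "has_hamiltonian_path_between G a b \<longleftrightarrow> has_hamiltonian_path_between G b a"
proof -
  have "has_hamiltonian_path_between G b a" if ab: "has_hamiltonian_path_between G a b" for a b
  proof -
    obtain p where p: "a \<noteq> b" "hamiltonian_path G p" "hd p = a" "last p = b"
      using ab by (auto simp: has_hamiltonian_path_between_def)
    have "hamiltonian_path G (rev p)"
      using p(2) by (simp add: hamiltonian_path_def path_in_rev)
    then show ?thesis
      using p by (auto simp: has_hamiltonian_path_between_def hd_rev last_rev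
          intro!: exI[of _ "rev p"])
  qed
  then show ?thesis by blast
qed

text \<open>In \<open>H - y\<close> no path ends at \<open>y\<close>, so \<open>P0\<close> provides
  the path from \<open>a\<close> to \<open>x\<close>, and symmetrically with \<open>x\<close>
  deleted. Since the ends of such a path differ, this also excludes \<open>a = x\<close> and
  \<open>a = y\<close>.\<close>

lemma weak_fragmentD:
  assumes "weak_fragment H a x y"
  shows "simple_graph H" "a \<in> verts H" "x \<in> verts H" "y \<in> verts H"
    and "x \<noteq> y" "a \<noteq> x" "a \<noteq> y"
    and "has_hamiltonian_path_between (delete_vertex H y) a x"
    and "has_hamiltonian_path_between (delete_vertex H x) a y"
proof -
  show basic: "simple_graph H" "a \<in> verts H" "x \<in> verts H" "y \<in> verts H"
    using assms by (auto simp: weak_fragment_def)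
  show xy: "x \<noteq> y"
    using assms simple_graph_edgeD(3)[of H x y] by (auto simp: weak_fragment_def)
  have P0: "has_hamiltonian_path_between (delete_vertex H v) a x \<or>
      has_hamiltonian_path_between (delete_vertex H v) a y" if "v \<in> verts H - {a}" for v
    using assms that by (auto simp: weak_fragment_def fragment_P0_def)
  show ay: "a \<noteq> y"
    using P0[of x] has_hamiltonian_path_between_verts[of "delete_vertex H x" a] basic xy by auto
  show ax: "a \<noteq> x"
    using P0[of y] has_hamiltonian_path_between_verts[of "delete_vertex H y" a] basic xy by auto
  show "has_hamiltonian_path_between (delete_vertex H y) a x"
    using P0[of y] has_hamiltonian_path_between_verts(2)[of "delete_vertex H y" a y] basic ay by auto
  show "has_hamiltonian_path_between (delete_vertex H x) a y"
    using P0[of x] has_hamiltonian_path_between_verts(2)[of "delete_vertex H x" a x] basic ax by auto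
qed

text \<open>Reduces the two alternatives of \<open>P0\<close> to the one in which the path ends at
  \<open>x\<close>.\<close>

lemma weak_fragment_swap: "weak_fragment H a x y \<longleftrightarrow> weak_fragment H a y x"
  by (auto simp: weak_fragment_def fragment_P0_def insert_commute)

section \<open>Hamiltonian paths in the join and in its vertex-deleted subgraphs\<close>

lemma has_hamiltonian_path_between_glue:
  assumes "has_hamiltonian_path_between H1 a z" "has_hamiltonian_path_between H2 b z"
    "verts H1 \<inter> verts H2 = {z}"
    "verts G = verts H1 \<union> verts H2" "edges H1 \<subseteq> edges G" "edges H2 \<subseteq> edges G"
  shows "has_hamiltonian_path_between G a b"
proof -
  \<comment> \<open>The only common vertex is \<open>z\<close>, and both \<open>a\<close> and
    \<open>b\<close> differ from it.\<close>
  have "a \<noteq> b" using has_hamiltonian_path_between_verts[OF assms(1)]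
    has_hamiltonian_path_between_verts[OF assms(2)] assms(3) by auto
  obtain p where p: "hamiltonian_path H1 p" "hd p = a" "last p = z"
    using assms(1) by (auto simp: has_hamiltonian_path_between_def)
  obtain q where q: "hamiltonian_path H2 q" "hd q = z" "last q = b" "z \<noteq> b"
    using assms(2) has_hamiltonian_path_between_commute[of H2 b z]
    by (auto simp: has_hamiltonian_path_between_def)
  have "hamiltonian_path G (p @ tl q)"
    using p q assms by (intro hamiltonian_path_glue[of H1 p H2 q G]) auto
  moreover have "hd (p @ tl q) = a" "last (p @ tl q) = b"
    using p q by (cases p; cases q; auto simp: hamiltonian_path_def path_in_iff)+
  ultimately show ?thesis using \<open>a \<noteq> b\<close> unfolding has_hamiltonian_path_between_def by blast
qed

text \<open>If the path of \<open>G1\<close> ends at \<open>x\<close>, it has already visited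
  \<open>y\<close>, so it is continued from \<open>x\<close> to \<open>a2\<close> through
  \<open>G2 - y\<close>. The case of \<open>y\<close> is symmetric.\<close>

lemma join_hamiltonian_path:
  assumes w: "weak_fragment G1 a1 x y" "weak_fragment G2 a2 x y"
    and V: "verts G1 \<inter> verts G2 = {x, y}"
  shows "has_hamiltonian_path_between (join G1 G2) a1 a2"
proof -
  have *: "has_hamiltonian_path_between (join G1 G2) a1 a2"
    if "has_hamiltonian_path_between G1 a1 x" "weak_fragment G2 a2 x y"
      "verts G1 \<inter> verts G2 = {x, y}" for x y
    using that weak_fragmentD(5,8)[OF that(2)]
    by (intro has_hamiltonian_path_between_glue[of G1 a1 x "delete_vertex G2 y" a2])
      (auto simp: delete_vertex_def)
  have "has_hamiltonian_path_between G1 a1 x \<or> has_hamiltonian_path_between G1 a1 y"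
    using w by (auto simp: weak_fragment_def fragment_P0_def)
  then show ?thesis
    using *[of x y] *[of y x] w(2) V weak_fragment_swap[of G2 a2 x y] insert_commute[of x y]
    by metis
qed

text \<open>The same continuation, now for a path of \<open>G1 - v\<close> that ends at
  \<open>x\<close>, and again through \<open>G2 - y\<close>.\<close>

lemma join_delete_hamiltonian_path:
  assumes w: "weak_fragment G1 a1 x y" "weak_fragment G2 a2 x y"
    and V: "verts G1 \<inter> verts G2 = {x, y}" and v: "v \<in> verts G1 - {a1}"
  shows "has_hamiltonian_path_between (delete_vertex (join G1 G2) v) a1 a2"
proof -
  have *: "has_hamiltonian_path_between (delete_vertex (join G1 G2) v) a1 a2"
    if ham: "has_hamiltonian_path_between (delete_vertex G1 v) a1 x"
      and w2: "weak_fragment G2 a2 x y" and V: "verts G1 \<inter> verts G2 = {x, y}" for x y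
  proof -
    have vx: "v \<noteq> x" using has_hamiltonian_path_between_verts(2)[OF ham] by auto
    \<comment> \<open>Here \<open>v = y\<close> is possible; then \<open>y\<close> is absent from
      both parts, as it should be.\<close>
    have v2: "v \<notin> verts G2 - {y}" using v V vx by auto
    have "edges (delete_vertex G2 y) \<subseteq> edges (delete_vertex (join G1 G2) v)"
    proof
      fix e assume e: "e \<in> edges (delete_vertex G2 y)"
      have "e \<subseteq> verts G2 - {y}"
        using e simple_delete_vertex[OF weak_fragmentD(1)[OF w2], of y]
        by (auto simp: simple_graph_def)
      then show "e \<in> edges (delete_vertex (join G1 G2) v)"
        using e v2 by (auto simp: delete_vertex_def)
    qed
    moreover have "edges (delete_vertex G1 v) \<subseteq> edges (delete_vertex (join G1 G2) v)"
      by (auto simp: delete_vertex_def)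
    moreover have "verts (delete_vertex (join G1 G2) v)
        = verts (delete_vertex G1 v) \<union> verts (delete_vertex G2 y)"
      using v2 V vx by auto
    moreover have "verts (delete_vertex G1 v) \<inter> verts (delete_vertex G2 y) = {x}"
      using V vx weak_fragmentD(5)[OF w2] by auto
    ultimately show ?thesis
      using has_hamiltonian_path_between_glue[OF ham weak_fragmentD(8)[OF w2]] by blast
  qed
  have "has_hamiltonian_path_between (delete_vertex G1 v) a1 x \<or>
      has_hamiltonian_path_between (delete_vertex G1 v) a1 y"
    using w v by (auto simp: weak_fragment_def fragment_P0_def)
  then show ?thesis
    using *[of x y] *[of y x] w(2) V weak_fragment_swap[of G2 a2 x y] insert_commute[of x y]
    by metis
qed

text \<open>The path of \<open>G1 - y\<close> from \<open>a1\<close> to \<open>x\<close> loses its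
  first vertex and is followed by a hamiltonian path of \<open>G2\<close> from \<open>x\<close> to
  \<open>a2\<close>, which supplies \<open>y\<close>. The new first vertex is not
  controlled.\<close>

lemma join_delete_end_hamiltonian_path:
  assumes w: "weak_fragment G1 a1 x y" "weak_fragment G2 a2 x y"
    and V: "verts G1 \<inter> verts G2 = {x, y}"
  shows "\<exists>q. hamiltonian_path (delete_vertex (join G1 G2) a1) q \<and> last q = a2 \<and> length q \<ge> 2"
proof -
  let ?D = "delete_vertex (join G1 G2) a1"
  have *: "\<exists>q. hamiltonian_path ?D q \<and> last q = a2 \<and> length q \<ge> 2"
    if ham: "has_hamiltonian_path_between G2 a2 x"
      and w1: "weak_fragment G1 a1 x y" and w2: "weak_fragment G2 a2 x y"
      and V: "verts G1 \<inter> verts G2 = {x, y}" for x y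
  proof -
    let ?H = "delete_vertex (delete_vertex G1 y) a1"
    note f = weak_fragmentD[OF w1]
    obtain p where p: "hamiltonian_path (delete_vertex G1 y) p" "hd p = a1" "last p = x"
      using f(8) by (auto simp: has_hamiltonian_path_between_def)
    \<comment> \<open>A second vertex exists because \<open>a1\<close> and \<open>x\<close> differ;
      \<open>c # r\<close> is the path that remains after the deletion of \<open>a1\<close>.\<close>
    then obtain c r where pr: "p = a1 # c # r"
      using f(6) by (cases p; cases "tl p") (auto simp: hamiltonian_path_def path_in_iff)
    have cr: "hamiltonian_path ?H (c # r)"
    proof -
      have d: "a1 \<notin> set (c # r)" and s: "successively (adj (delete_vertex G1 y)) (c # r)"
        using p(1) by (auto simp: pr hamiltonian_path_def path_in_iff)
      have "successively (adj ?H) (c # r)"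
        using d by (intro successively_mono[OF s]) (auto simp: delete_vertex_def)
      then show ?thesis
        using p(1) d by (auto simp: pr hamiltonian_path_def path_in_iff)
    qed
    obtain q where q: "hamiltonian_path G2 q" "hd q = x" "last q = a2" "a2 \<noteq> x"
      using ham has_hamiltonian_path_between_commute[of G2 a2 x]
      by (auto simp: has_hamiltonian_path_between_def)
    have a1: "a1 \<notin> verts G2" using f V by auto
    have e: "edges G2 \<subseteq> edges ?D"
      using a1 weak_fragmentD(1)[OF w2] by (auto simp: delete_vertex_def simple_graph_def)
    have e': "edges ?H \<subseteq> edges ?D" by (auto simp: delete_vertex_def)
    have V1: "verts ?H \<inter> verts G2 = {x}" using V f by auto
    have V2: "verts ?D = verts ?H \<union> verts G2" using V a1 by auto
    have "hamiltonian_path ?D ((c # r) @ tl q)"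
      using p(3) V1 q(2) by (intro hamiltonian_path_glue[OF cr q(1) _ _ V2 e' e]) (simp_all add: pr)
    moreover obtain d q' where "q = x # d # q'"
      using q by (cases q; cases "tl q") (auto simp: hamiltonian_path_def path_in_iff)
    ultimately show ?thesis
      using q(3) by (intro exI[of _ "(c # r) @ tl q"]) auto
  qed
  have "has_hamiltonian_path_between G2 a2 x \<or> has_hamiltonian_path_between G2 a2 y"
    using w by (auto simp: weak_fragment_def fragment_P0_def)
  then show ?thesis
    using *[of x y] *[of y x] w V weak_fragment_swap[of G1 a1 x y] weak_fragment_swap[of G2 a2 x y]
      insert_commute[of x y]
    by metis
qed

section \<open>Non-hamiltonicity of the join and of its vertex-deleted subgraphs\<close>

lemma join_not_hamiltonian:
  assumes w: "weak_fragment G1 a1 x y" "weak_fragment G2 a2 x y"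
    and V: "verts G1 \<inter> verts G2 = {x, y}" and Q: "fragment_Q1 G1 x y"
  shows "\<not> hamiltonian (join G1 G2)"
  using hamiltonian_join_path[of G1 G2 x y a1 a2] Q V weak_fragmentD[OF w(1)] weak_fragmentD[OF w(2)]
  by (auto simp: fragment_Q1_def)

text \<open>If \<open>v\<close> is \<open>x\<close> or \<open>y\<close>, the other one is a cut
  vertex. Otherwise a hamiltonian cycle would yield hamiltonian \<open>xy\<close>-paths of
  \<open>G1 - v\<close> and of \<open>G2\<close>; \<open>Q2\<close> forbids the former and
  \<open>Q1\<close> the latter.\<close>

lemma join_delete_not_hamiltonian:
  assumes w: "weak_fragment G1 a1 x y" "weak_fragment G2 a2 x y"
    and V: "verts G1 \<inter> verts G2 = {x, y}"
    and Q: "fragment_Q2 G1 a1 x y \<or> fragment_Q1 G2 x y"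
    and v: "v \<in> verts G1 - {a1}"
  shows "\<not> hamiltonian (delete_vertex (join G1 G2) v)"
proof -
  note f1 = weak_fragmentD[OF w(1)] and f2 = weak_fragmentD[OF w(2)]
  have sg: "simple_graph (delete_vertex G1 v)" "simple_graph (delete_vertex G2 v)"
    using f1 f2 by (auto intro: simple_delete_vertex)
  show ?thesis
  proof (cases "v \<in> {x, y}")
    case True
    then obtain z where "{x, y} = {v, z}" "v \<noteq> z" using f1(5) by auto
    then have "\<not> hamiltonian (join (delete_vertex G1 v) (delete_vertex G2 v))"
      using V f1 f2 True
      by (intro cut_vertex_not_hamiltonian[OF sg, of z a1 a2]) auto
    then show ?thesis by (simp add: delete_vertex_join)
  next
    case False
    then have "v \<notin> verts G2" using v V by auto
    then have eq: "delete_vertex G2 v = G2" using delete_vertex_idem f2(1) by metis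
    have V': "verts (delete_vertex G1 v) \<inter> verts G2 = {x, y}" using V False by auto
    have a: "a1 \<in> verts (delete_vertex G1 v) - {x, y}" "a2 \<in> verts G2 - {x, y}"
      using f1 f2 v by auto
    show ?thesis
    proof
      assume "hamiltonian (delete_vertex (join G1 G2) v)"
      then have h: "hamiltonian (join (delete_vertex G1 v) G2)"
        by (simp add: delete_vertex_join eq)
      have "has_hamiltonian_path_between (delete_vertex G1 v) x y"
        by (rule hamiltonian_join_path[OF sg(1) f2(1) V' f1(5) a h])
      \<comment> \<open>The same splitting with the two sides exchanged.\<close>
      moreover have "has_hamiltonian_path_between G2 x y"
        using hamiltonian_join_path[OF f2(1) sg(1) _ f1(5) a(2,1)] h V'
        by (simp add: join_commute Int_commute)
      ultimately show False using Q v by (auto simp: fragment_Q1_def fragment_Q2_def)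
    qed
  qed
qed

theorem theorem9:
  fixes G1 G2 :: "'a graph" and a1 a2 x y :: 'a
  assumes "weak_fragment G1 a1 x y" and "weak_fragment G2 a2 x y"
    and "verts G1 \<inter> verts G2 = {x, y}"
    and "(medium_fragment G1 a1 x y \<and> medium_fragment G2 a2 x y) \<or>
         strong_fragment G1 a1 x y \<or> strong_fragment G2 a2 x y"
  shows "traceable (join G1 G2) \<and> fault_cost (join G1 G2) = 1"
proof
  let ?G = "join G1 G2"
  note w = assms(1,2) and V = assms(3)
  note f1 = weak_fragmentD[OF w(1)] and f2 = weak_fragmentD[OF w(2)]
  have V': "verts G2 \<inter> verts G1 = {x, y}" using V by auto
  \<comment> \<open>Two medium fragments satisfy \<open>Q1\<close> on both sides, while a single
    strong one satisfies \<open>Q1\<close> and \<open>Q2\<close> on its own side. Either way, these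
    facts exclude a hamiltonian cycle in the join, after deletions in \<open>G1\<close>, and after
    deletions in \<open>G2\<close>.\<close>
  have Q: "fragment_Q1 G1 x y \<or> fragment_Q1 G2 x y"
    "fragment_Q2 G1 a1 x y \<or> fragment_Q1 G2 x y"
    "fragment_Q2 G2 a2 x y \<or> fragment_Q1 G1 x y"
    using assms(4) by (auto simp: medium_fragment_def strong_fragment_def)
  obtain p where p: "hamiltonian_path ?G p" "hd p = a1" "last p = a2" and ne: "a1 \<noteq> a2"
    using join_hamiltonian_path[OF w V] by (auto simp: has_hamiltonian_path_between_def)
  then show "traceable ?G" by (auto simp: traceable_def)
  have long: "length q \<ge> 2" if "hd q = a1" "last q = a2" "hamiltonian_path H q" for H q
    using that ne by (cases q; cases "tl q") (auto simp: hamiltonian_path_def path_in_iff)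
  have nh: "\<not> hamiltonian ?G"
    using Q(1) join_not_hamiltonian[OF w V] join_not_hamiltonian[OF w(2,1) V']
    by (auto simp: join_commute)
  have Sv: "\<exists>Sv\<in>ml_subgraphs (delete_vertex ?G v). transition_cost ?G v (path_graph p) Sv \<le> 1"
    if v: "v \<in> verts ?G" for v
  proof -
    consider "v = a1" | "v = a2" | "v \<noteq> a1" "v \<noteq> a2" by blast
    then show ?thesis
    proof cases
      case 1
      then show ?thesis
        using join_delete_end_hamiltonian_path[OF w V] fault_end_vertex[OF p(1), of a1 a2] p ne
        by auto
    next
      case 2
      then show ?thesis
        using join_delete_end_hamiltonian_path[OF w(2,1) V'] fault_end_vertex[OF p(1), of a2 a1] p ne
        by (auto simp: join_commute[of G2 G1])
    next
      case 3
      have "has_hamiltonian_path_between (delete_vertex ?G v) a1 a2"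
        using join_delete_hamiltonian_path[OF w V, of v]
          join_delete_hamiltonian_path[OF w(2,1) V', of v] v 3
          has_hamiltonian_path_between_commute[of "delete_vertex ?G v" a1 a2]
        by (auto simp: join_commute[of G2 G1])
      then obtain q where q: "hamiltonian_path (delete_vertex ?G v) q" "hd q = a1" "last q = a2"
        by (auto simp: has_hamiltonian_path_between_def)
      have "\<not> hamiltonian (delete_vertex ?G v)"
        using join_delete_not_hamiltonian[OF w V Q(2), of v]
          join_delete_not_hamiltonian[OF w(2,1) V' Q(3), of v] v 3
        by (auto simp: join_commute[of G2 G1])
      then have "path_graph q \<in> ml_subgraphs (delete_vertex ?G v)"
        using path_graph_ml_subgraph q long by blast
      \<comment> \<open>The paths \<open>p\<close> and \<open>q\<close> have the same ends
        \<open>a1\<close> and \<open>a2\<close>, so no degree changes at all, and the exceptional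
        vertex of the bound may be arbitrary.\<close>
      moreover have "transition_cost ?G v (path_graph p) (path_graph q) \<le> 1"
      proof (rule transition_cost_le_1)
        fix u assume "u \<in> verts ?G - {v}"
        then show "degree (path_graph p) u = degree (path_graph q) u"
          using degree_path_graph[of p u] degree_path_graph[of q u] p q
          by (auto simp: hamiltonian_path_def path_in_iff)
      qed
      ultimately show ?thesis by blast
    qed
  qed
  show "fault_cost ?G = 1"
  proof (rule antisym)
    have "fault_cost_wrt ?G (path_graph p) \<le> 1"
      unfolding fault_cost_wrt_def
    proof (rule SUP_least)
      fix v assume "v \<in> verts ?G"
      then obtain T where "T \<in> ml_subgraphs (delete_vertex ?G v)"
          "transition_cost ?G v (path_graph p) T \<le> 1"
        using Sv by blast
      then show "(INF Sv\<in>ml_subgraphs (delete_vertex ?G v).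
          enat (transition_cost ?G v (path_graph p) Sv)) \<le> 1"
        by (intro INF_lower2[of T]) (auto simp: one_enat_def)
    qed
    moreover have "path_graph p \<in> ml_subgraphs ?G"
      using path_graph_ml_subgraph[OF nh p(1)] long p by blast
    ultimately show "fault_cost ?G \<le> 1"
      unfolding fault_cost_def by (intro INF_lower2)
    show "1 \<le> fault_cost ?G"
      using fault_cost_ge_1[OF nh, of a1 a2] f1 f2 ne by auto
  qed
qed

end
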